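(* Let $q$ be a fixed prime power. Let $n$ be a positive integer and let $m=m(n)>0$ be such that $m=o(n)$. Then, for every $0<\epsilon<1$, $$\Psi_2(n,m)\ll_\epsilon \frac{q^n}{n^\epsilon}+q^n\frac{m}{n},$$ where the implied constant depends only on $\epsilon$ (and on the fixed $q$).
   Context: A prime in $\mathbb{F}_q[T]$ is a monic irreducible polynomial. For monic $A\in\mathbb{F}_q[T]$, $\mathcal{N}(A)=\{\deg P: P\text{ prime}, P\mid A\}$ is the set of distinct degrees of prime divisors of $A$, and $\Delta_2(A)$ is the second largest element of $\mathcal{N}(A)$, with $\Delta_2(A)=0$ if $\mathcal{N}(A)$ has fewer than two elements. Define $$\Psi_2(n,m)=\#\{A\in\mathbb{F}_q[T]: A\text{ monic},\ \deg A=n,\ \Delta_2(A)\le m\}.$$ *)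

theory Defs
  imports
    "HOL-Computational_Algebra.Computational_Algebra"
    "HOL-Library.Landau_Symbols"
begin

definition prime_degrees :: "'a::field poly \<Rightarrow> nat set" where
  "prime_degrees A = {degree P | P. lead_coeff P = 1 \<and> irreducible P \<and> P dvd A}"

definition Delta2 :: "'a::field poly \<Rightarrow> nat" where
  "Delta2 A = (if card (prime_degrees A) < 2 then 0
     else Max (prime_degrees A - {Max (prime_degrees A)}))"

definition Psi2 :: "'a::finite_field itself \<Rightarrow> nat \<Rightarrow> real \<Rightarrow> nat" where
  "Psi2 F n m = card {A :: 'a poly. lead_coeff A = 1 \<and> degree A = n \<and> real (Delta2 A) \<le> m}"

text \<open>
  The sets under \<^const>\<open>card\<close> and \<^const>\<open>Max\<close> above are finite, so these operators have
  their intended meaning.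
\<close>

lemma finite_prime_degrees:
  assumes "A \<noteq> 0"
  shows "finite (prime_degrees A)"
proof (rule finite_subset)
  show "prime_degrees A \<subseteq> {..degree A}"
    using assms by (auto simp: prime_degrees_def intro: dvd_imp_degree_le)
qed simp

lemma finite_monic_degree:
  "finite {A :: 'a::finite_field poly. lead_coeff A = 1 \<and> degree A = n \<and> Q A}"
proof (rule finite_subset)
  show "{A :: 'a poly. lead_coeff A = 1 \<and> degree A = n \<and> Q A}
          \<subseteq> Poly ` {xs. set xs \<subseteq> UNIV \<and> length xs \<le> Suc n}"
  proof
    fix A :: "'a poly"
    assume "A \<in> {A. lead_coeff A = 1 \<and> degree A = n \<and> Q A}"
    then have "length (coeffs A) \<le> Suc n"
      by (cases "A = 0") (auto simp: length_coeffs_degree)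
    then show "A \<in> Poly ` {xs. set xs \<subseteq> UNIV \<and> length xs \<le> Suc n}"
      by (intro image_eqI[of _ _ "coeffs A"]) auto
  qed
qed (intro finite_imageI finite_lists_length_le finite)

end

theory Submission
  imports Defs "HOL-Library.Cardinality"
begin

text \<open>
  Let \<open>S\<close> be the set of monic \<open>A\<close> of degree \<open>n\<close> with \<open>Delta2 A \<le> M\<close>, where \<open>M = \<lfloor>m\<rfloor>\<close>.
  Summing \<open>n = deg A = (\<Sum>P^j | A, j \<ge> 1. deg P)\<close> over \<open>A \<in> S\<close> writes \<open>n * card S\<close> as a sum over
  triples \<open>(A, P, j)\<close> weighted by \<open>d = deg P\<close>.

  \<^item> Triples with \<open>d \<le> M\<close> contribute at most \<open>2 * M * q^n\<close>, even for \<open>A\<close> unrestricted.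
  \<^item> If \<open>d > M\<close> and \<open>A / P^j\<close> still has a prime factor of degree \<open>> M\<close>, that degree is \<open>d\<close>
    again, and pairs of primes of equal degree \<open>d\<close> contribute \<open>O(q^n / d)\<close>, in total
    \<open>O(q^n * log n)\<close>.
  \<^item> If \<open>d > M\<close> and \<open>B = A / P^j\<close> is \<open>M\<close>-smooth, the weighted number of prime powers
    of degree \<open>n - deg B\<close> is \<open>q^(n - deg B)\<close>, so one needs \<open>(\<Sum>B smooth. q^(- deg B)) = O(M + 1)\<close>.

  Hence \<open>card S\<close> is \<open>O(q^n * (m + 1 + log n) / n)\<close>, which is stronger than the claim.
\<close>

section \<open>Monic polynomials, their number and their multiples\<close>

definition monics :: "nat \<Rightarrow> 'a::field poly set" where
  "monics n = {A. lead_coeff A = 1 \<and> degree A = n}"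

definition mprimes :: "nat \<Rightarrow> 'a::field poly set" where
  "mprimes d = {P. lead_coeff P = 1 \<and> irreducible P \<and> degree P = d}"

lemma monicsD: "A \<in> monics n \<Longrightarrow> lead_coeff A = 1" "A \<in> monics n \<Longrightarrow> degree A = n"
  "A \<in> monics n \<Longrightarrow> A \<noteq> 0"
  by (auto simp: monics_def)

lemma mprimesD:
  assumes "P \<in> mprimes d"
  shows "lead_coeff P = 1" "irreducible P" "degree P = d" "P \<in> monics d" "P \<noteq> 0"
  using assms by (auto simp: mprimes_def monics_def)

lemma finite_monics [simp]: "finite (monics n :: 'a::finite_field poly set)"
  using finite_monic_degree[of n "\<lambda>_. True"] by (simp add: monics_def)

lemma finite_mprimes [simp]: "finite (mprimes n :: 'a::finite_field poly set)"
  by (rule finite_subset[OF _ finite_monics[of n]]) (auto simp: mprimes_def monics_def)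

lemma card_monics: "card (monics n :: 'a::finite_field poly set) = CARD('a) ^ n"
proof (induction n)
  case 0
  have "monics 0 = {1 :: 'a poly}"
    by (auto simp: monics_def elim!: degree_eq_zeroE)
  then show ?case by simp
next
  case (Suc n)
  have "monics (Suc n) = (\<lambda>(a, p). pCons a p) ` (UNIV \<times> (monics n :: 'a poly set))"
  proof (intro equalityI subsetI)
    fix A :: "'a poly" assume A: "A \<in> monics (Suc n)"
    obtain a p where "A = pCons a p" by (cases A)
    with A show "A \<in> (\<lambda>(a, p). pCons a p) ` (UNIV \<times> monics n)"
      by (auto simp: monics_def split: if_splits intro!: image_eqI[of _ _ "(a, p)"])
  next
    fix A :: "'a poly" assume "A \<in> (\<lambda>(a, p). pCons a p) ` (UNIV \<times> monics n)"
    then show "A \<in> monics (Suc n)" by (auto simp: monics_def)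
  qed
  moreover have "inj_on (\<lambda>(a, p). pCons a p) (UNIV \<times> (monics n :: 'a poly set))"
    by (auto simp: inj_on_def)
  ultimately show ?case
    by (simp add: card_image card_cartesian_product Suc)
qed

lemma monics_mult:
  assumes "A \<in> monics m" "B \<in> monics n"
  shows "A * B \<in> monics (m + n)"
proof -
  have "degree (A * B) = m + n"
    using monicsD[OF assms(1)] monicsD[OF assms(2)] by (simp add: degree_mult_eq)
  then show ?thesis
    using monicsD(1)[OF assms(1)] monicsD(1)[OF assms(2)] lead_coeff_mult[of A B]
    by (simp add: monics_def)
qed

lemma monics_power:
  assumes "A \<in> monics m"
  shows "A ^ j \<in> monics (j * m)"
proof -
  have "degree (A ^ j) = j * m"
    using monicsD[OF assms] by (simp add: degree_power_eq)
  then show ?thesis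
    using monicsD(1)[OF assms] lead_coeff_power[of A j] by (simp add: monics_def)
qed

lemma monics_cancel:
  assumes "D \<in> monics e" "D * B \<in> monics n"
  shows "e \<le> n" "B \<in> monics (n - e)"
proof -
  have "B \<noteq> 0" using monicsD(3)[OF assms(2)] by auto
  then have "degree (D * B) = e + degree B"
    using monicsD[OF assms(1)] by (simp add: degree_mult_eq)
  moreover have "lead_coeff B = 1"
    using monicsD(1)[OF assms(1)] monicsD(1)[OF assms(2)] lead_coeff_mult[of D B] by simp
  ultimately show "e \<le> n" "B \<in> monics (n - e)"
    using monicsD(2)[OF assms(2)] by (auto simp: monics_def)
qed

text \<open>Multiplication by \<open>D\<close> is injective and cofactors of monic multiples are
  monic, so multiples correspond to cofactors. The set \<open>S\<close> is left general to serve for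
  all monics, for smooth ones and for those with small \<open>Delta2\<close>. The case
  \<open>e > n\<close> is separated because \<open>n - e\<close> truncates to 0.\<close>

lemma card_multiples:
  assumes "D \<in> monics e" and "S \<subseteq> monics n"
  shows "card {A \<in> S. D dvd A} =
    (if e \<le> n then card {B \<in> monics (n - e). D * B \<in> S} else 0)"
proof -
  have "{A \<in> S. D dvd A} = (\<lambda>B. D * B) ` (if e \<le> n then {B \<in> monics (n - e). D * B \<in> S} else {})"
    using assms monics_cancel[OF assms(1), of _ n] by (auto simp: dvd_def)
  moreover have "inj_on (\<lambda>B. D * B) X" for X
    using monicsD(3)[OF assms(1)] by (auto simp: inj_on_def)
  ultimately show ?thesis by (auto simp: card_image)
qed

lemma card_monic_multiples:
  fixes D :: "'a::finite_field poly"
  assumes "D \<in> monics e"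
  shows "card {A \<in> monics n. D dvd A} = (if e \<le> n then CARD('a) ^ (n - e) else 0)"
proof -
  have "{B \<in> monics (n - e). D * B \<in> monics n} = monics (n - e)" if "e \<le> n"
    using monics_mult[OF assms, of _ "n - e"] that by auto
  then show ?thesis
    using card_multiples[OF assms, of "monics n" n] by (simp add: card_monics)
qed

section \<open>Monic irreducible factors and their multiplicities\<close>

lemma exists_monic_irreducible_factor:
  fixes A :: "'a::field poly"
  assumes "degree A > 0"
  obtains P where "P \<in> mprimes (degree P)" "P dvd A"
proof -
  have "\<exists>P. lead_coeff P = 1 \<and> irreducible P \<and> P dvd A"
    using assms
  proof (induction "degree A" arbitrary: A rule: less_induct)
    case less
    show ?case
    proof (cases "irreducible A")
      case True
      define P where "P = smult (inverse (lead_coeff A)) A"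
      have "A \<noteq> 0" using less.prems by auto
      then have "lead_coeff P = 1" "P dvd A" "irreducible P"
        using True irreducible_mult_unit_left[of "[:inverse (lead_coeff A):]" A]
        by (simp_all add: P_def smult_dvd_iff is_unit_iff_degree)
      then show ?thesis by blast
    next
      case False
      then obtain B C where BC: "A = B * C" "\<not> is_unit B" "\<not> is_unit C"
        using less.prems by (cases "A = 0") (auto simp: irreducible_def is_unit_iff_degree)
      then have "B \<noteq> 0" "C \<noteq> 0" using less.prems by auto
      then have "degree B > 0" "degree B < degree A"
        using BC by (auto simp: is_unit_iff_degree degree_mult_eq)
      then obtain P where "lead_coeff P = 1 \<and> irreducible P \<and> P dvd B"
        using less.hyps by blast
      then show ?thesis using BC by (auto intro: dvd_mult2)
    qed
  qed
  then show thesis using that by (auto simp: mprimes_def)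
qed

lemma degree_mprime_pos: "P \<in> mprimes d \<Longrightarrow> d > 0"
  using mprimesD(2)[of P d] mprimesD(3)[of P d] mprimesD(5)[of P d]
  by (auto simp: irreducible_def is_unit_iff_degree intro!: gr0I)

lemma mprime_dvd_mprime:
  assumes "P \<in> mprimes d" "Q \<in> mprimes e" "P dvd Q"
  shows "P = Q"
proof -
  have "Q dvd P"
    using irreducibleD'[OF mprimesD(2)[OF assms(2)] assms(3)] mprimesD(2)[OF assms(1)]
    by (auto simp: irreducible_not_unit)
  then obtain c where c: "P = Q * c" by auto
  have nz: "P \<noteq> 0" "Q \<noteq> 0" using mprimesD(5) assms by blast+
  then have "c \<noteq> 0" using c by auto
  then have "degree P = degree Q + degree c" using nz c by (simp add: degree_mult_eq)
  moreover have "degree P \<le> degree Q" using assms(3) nz(2) by (rule dvd_imp_degree_le)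
  ultimately have "degree c = 0" by simp
  moreover have "lead_coeff c = 1"
    using mprimesD(1)[OF assms(1)] mprimesD(1)[OF assms(2)] lead_coeff_mult[of Q c] c by simp
  ultimately show ?thesis using c by (auto elim!: degree_eq_zeroE)
qed

text \<open>The multiplicity of \<open>P\<close> is expressed as the number of exponents
  \<open>j\<close> with \<open>P ^ j\<close> dividing the polynomial. For \<open>P = Q\<close> the
  exponents for \<open>Q * B\<close> are 1 and the successors of those for \<open>B\<close>;
  otherwise \<open>P\<close> is a prime element not dividing \<open>Q\<close>, and no exponent
  changes.\<close>

lemma card_powers_dvd_mprime_mult:
  assumes P: "P \<in> mprimes d" and Q: "Q \<in> mprimes e" and B: "Q * B \<noteq> 0" "degree (Q * B) \<le> N"
  shows "card {j \<in> {1..N}. P ^ j dvd Q * B} =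
    card {j \<in> {1..N}. P ^ j dvd B} + (if P = Q then 1 else 0)"
proof (cases "P = Q")
  case True
  have [simp]: "P \<noteq> 0" and d: "d > 0" using mprimesD(5)[OF P] degree_mprime_pos[OF P] by auto
  \<comment> \<open>The degree bound on \<open>Q * B\<close> ensures that the shifted exponent
    \<open>j + 1\<close> still lies in \<open>{1..N}\<close>, so the cutoff loses nothing.\<close>
  have lt: "j < N" if "P ^ j dvd B" for j
  proof -
    have "P ^ Suc j dvd Q * B" using that True by (simp add: mult_dvd_mono)
    then have "degree (P ^ Suc j) \<le> N"
      using B dvd_imp_degree_le order_trans by blast
    then have "Suc j * d \<le> N"
      using mprimesD(3)[OF P] by (simp add: degree_power_eq del: power_Suc)
    moreover have "Suc j * 1 \<le> Suc j * d" using d by (intro mult_le_mono2) simp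
    ultimately show ?thesis by simp
  qed
  have *: "P ^ j dvd Q * B \<longleftrightarrow> P ^ (j - 1) dvd B" if "j \<ge> 1" for j
    using that True by (cases j) auto
  have "{j \<in> {1..N}. P ^ j dvd Q * B} = insert 1 (Suc ` {j \<in> {1..N}. P ^ j dvd B})"
  proof (intro equalityI subsetI)
    fix j assume j: "j \<in> {j \<in> {1..N}. P ^ j dvd Q * B}"
    then obtain i where i: "j = Suc i" by (cases j) auto
    then have "P ^ i dvd B" using j *[of "Suc i"] by (simp del: power_Suc)
    then show "j \<in> insert 1 (Suc ` {j \<in> {1..N}. P ^ j dvd B})"
      using i j by (cases "i = 0") auto
  next
    fix j assume "j \<in> insert 1 (Suc ` {j \<in> {1..N}. P ^ j dvd B})"
    then obtain i where i: "j = Suc i" "P ^ i dvd B" by auto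
    then show "j \<in> {j \<in> {1..N}. P ^ j dvd Q * B}"
      using lt[of i] *[of j] by (simp del: power_Suc)
  qed
  then show ?thesis using True by (simp add: card_image card_insert_if image_iff)
next
  case False
  then have "\<not> P dvd Q" using mprime_dvd_mprime P Q by blast
  then have "P ^ j dvd Q * B \<longleftrightarrow> P ^ j dvd B" if "j \<ge> 1" for j
    using prime_power_dvd_multD[OF field_poly_irreducible_imp_prime[OF mprimesD(2)[OF P]], of j Q B] that
    by (auto intro: dvd_mult)
  then have "{j \<in> {1..N}. P ^ j dvd Q * B} = {j \<in> {1..N}. P ^ j dvd B}"
    by (intro Collect_cong conj_cong refl) simp
  then show ?thesis using False by simp
qed

text \<open>Splitting off one prime factor \<open>Q\<close> lowers exactly one multiplicity by one,
  hence both sides by \<open>degree Q\<close>. The cutoff \<open>N\<close> stays fixed during the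
  induction on the degree.\<close>

lemma sum_card_powers_dvd_eq_degree:
  fixes A :: "'a::finite_field poly"
  assumes "lead_coeff A = 1" "degree A \<le> N"
  shows "(\<Sum>d\<in>{1..N}. \<Sum>P\<in>mprimes d. d * card {j \<in> {1..N}. P ^ j dvd A}) = degree A"
  using assms
proof (induction "degree A" arbitrary: A rule: less_induct)
  case less
  show ?case
  proof (cases "degree A = 0")
    case True
    then have "A = 1" using less.prems by (auto elim!: degree_eq_zeroE)
    have "\<not> P dvd 1" if "P \<in> mprimes d" for P :: "'a poly" and d
      using mprimesD(2)[OF that] by (simp add: irreducible_not_unit)
    then have "{j \<in> {1..N}. P ^ j dvd A} = {}" if "P \<in> mprimes d" for P :: "'a poly" and d
      using that \<open>A = 1\<close> by (auto simp: is_unit_power_iff)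
    then show ?thesis using True by simp
  next
    case False
    then obtain Q where Q: "Q \<in> mprimes (degree Q)" "Q dvd A"
      using exists_monic_irreducible_factor by blast
    define e where "e = degree Q"
    have Q': "Q \<in> mprimes e" using Q e_def by simp
    from Q obtain B where A: "A = Q * B" by auto
    have "A \<in> monics (degree A)" using less.prems by (simp add: monics_def)
    then have B: "e \<le> degree A" "B \<in> monics (degree A - e)"
      using monics_cancel[of Q e B "degree A"] mprimesD(4)[OF Q'] A by auto
    have e: "e > 0" using Q' by (rule degree_mprime_pos)
    have AB: "Q * B \<noteq> 0" "degree (Q * B) \<le> N" using A less.prems by auto
    have IH: "(\<Sum>d\<in>{1..N}. \<Sum>P\<in>mprimes d. d * card {j \<in> {1..N}. P ^ j dvd B}) = degree B"
      by (rule less.hyps) (use B e False less.prems monicsD[OF B(2)] in auto)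
    have "(\<Sum>d\<in>{1..N}. \<Sum>P\<in>mprimes d. d * card {j \<in> {1..N}. P ^ j dvd A})
        = (\<Sum>d\<in>{1..N}. \<Sum>P\<in>mprimes d. d * card {j \<in> {1..N}. P ^ j dvd B})
          + (\<Sum>d\<in>{1..N}. \<Sum>P\<in>mprimes d. if P = Q then d else 0)"
      unfolding sum.distrib[symmetric] A
      by (intro sum.cong refl)
         (subst card_powers_dvd_mprime_mult[OF _ Q' AB], assumption, simp add: distrib_left)
    also have "(\<Sum>d\<in>{1..N}. \<Sum>P\<in>mprimes d. if P = Q then d else 0)
        = (\<Sum>d\<in>{1..N}. if d = e then e else 0)"
    proof (intro sum.cong refl)
      fix d
      have "Q \<in> mprimes d \<longleftrightarrow> d = e" using Q' by (auto simp: mprimes_def)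
      then show "(\<Sum>P\<in>mprimes d. if P = Q then d else 0) = (if d = e then e else 0)" by simp
    qed
    also have "\<dots> = e" using e B(1) less.prems by simp
    finally show ?thesis using IH B monicsD(2)[OF B(2)] by simp
  qed
qed

section \<open>Counting with prime powers weighted by degree\<close>

text \<open>Double counting: the degree identity is summed over \<open>S\<close> and the sum over
  \<open>A\<close> is moved inside. A cutoff \<open>N\<close> independent of \<open>n\<close> gives
  sets of different degrees the same index ranges.\<close>

lemma degree_weighted_count:
  fixes S :: "'a::finite_field poly set"
  assumes S: "S \<subseteq> monics n" and "n \<le> N"
  shows "n * card S = (\<Sum>d\<in>{1..N}. \<Sum>P\<in>mprimes d. \<Sum>j\<in>{1..N}. d * card {A \<in> S. P ^ j dvd A})"
proof -
  have fin: "finite S" using S finite_monics by (rule finite_subset)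
  have "n * card S = (\<Sum>A\<in>S. n)" by simp
  also have "\<dots> = (\<Sum>A\<in>S. \<Sum>d\<in>{1..N}. \<Sum>P\<in>mprimes d. d * card {j \<in> {1..N}. P ^ j dvd A})"
    by (intro sum.cong refl, subst sum_card_powers_dvd_eq_degree) (use S \<open>n \<le> N\<close> in \<open>auto simp: monics_def\<close>)
  also have "\<dots> = (\<Sum>A\<in>S. \<Sum>d\<in>{1..N}. \<Sum>P\<in>mprimes d. \<Sum>j\<in>{1..N}. d * of_bool (P ^ j dvd A))"
    by (intro sum.cong refl) (auto simp: sum_distrib_left[symmetric] Int_def)
  also have "\<dots> = (\<Sum>d\<in>{1..N}. \<Sum>P\<in>mprimes d. \<Sum>j\<in>{1..N}. \<Sum>A\<in>S. d * of_bool (P ^ j dvd A))"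
  proof -
    have "(\<Sum>P\<in>mprimes d. \<Sum>j\<in>{1..N}. \<Sum>A\<in>S. d * of_bool (P ^ j dvd A))
      = (\<Sum>A\<in>S. \<Sum>P\<in>mprimes d. \<Sum>j\<in>{1..N}. d * of_bool (P ^ j dvd A))" for d
      by (simp only: sum.swap[of _ S])
    then show ?thesis by (simp only: sum.swap[of _ S])
  qed
  also have "\<dots> = (\<Sum>d\<in>{1..N}. \<Sum>P\<in>mprimes d. \<Sum>j\<in>{1..N}. d * card {A \<in> S. P ^ j dvd A})"
    using fin by (intro sum.cong refl) (auto simp: sum_distrib_left[symmetric] Int_def)
  finally show ?thesis .
qed

text \<open>
  Counting all monic polynomials of degrees \<open>n\<close> and \<open>n + 1\<close> by weighted prime powers and
  subtracting leaves only the prime powers of degree exactly \<open>n + 1\<close>.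
\<close>
lemma sum_mprimes_eq_power:
  assumes "1 \<le> r" "r \<le> N"
  shows "(\<Sum>d\<in>{1..N}. \<Sum>j\<in>{1..N}. if j * d = r then d * card (mprimes d :: 'a::finite_field poly set) else 0)
    = CARD('a) ^ r"
proof -
  let ?q = "CARD('a)" and ?\<pi> = "\<lambda>d. card (mprimes d :: 'a poly set)"
  define T where "T n = (\<Sum>d\<in>{1..N}. \<Sum>j\<in>{1..N}. if j * d \<le> n then d * ?\<pi> d * ?q ^ (n - j * d) else 0)" for n
  have T: "T n = n * ?q ^ n" if "n \<le> N" for n
  proof -
    have "n * ?q ^ n = (\<Sum>d\<in>{1..N}. \<Sum>P\<in>(mprimes d :: 'a poly set). \<Sum>j\<in>{1..N}.
        d * card {A \<in> monics n. P ^ j dvd A})"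
      using degree_weighted_count[OF order_refl that, where 'a = 'a] by (simp add: card_monics)
    also have "\<dots> = (\<Sum>d\<in>{1..N}. \<Sum>P\<in>(mprimes d :: 'a poly set). \<Sum>j\<in>{1..N}.
        if j * d \<le> n then d * ?q ^ (n - j * d) else 0)"
      by (intro sum.cong refl)
         (simp add: card_monic_multiples[OF monics_power[OF mprimesD(4)]])
    also have "\<dots> = T n"
      unfolding T_def by (intro sum.cong refl, subst sum.swap, intro sum.cong refl) simp
    finally show ?thesis ..
  qed
  obtain n where r: "r = Suc n" using assms by (cases r) auto
  \<comment> \<open>A term with \<open>j * d \<le> n\<close> gains a factor \<open>?q\<close> when
    \<open>n\<close> becomes \<open>r\<close>; the terms with \<open>j * d = r\<close> are new and
    carry \<open>?q ^ 0\<close>. The difference is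
    \<open>r * ?q ^ r - n * ?q ^ r = ?q ^ r\<close>.\<close>
  have "T r = ?q * T n + (\<Sum>d\<in>{1..N}. \<Sum>j\<in>{1..N}. if j * d = r then d * ?\<pi> d else 0)"
    unfolding T_def sum_distrib_left sum.distrib[symmetric]
    by (intro sum.cong refl) (auto simp: r Suc_diff_le le_Suc_eq)
  then show ?thesis
    using T[of r] T[of n] assms by (simp add: r algebra_simps)
qed

section \<open>Upper bounds for sums over primes and prime powers\<close>

text \<open>All terms of the exact formula for \<open>CARD('a) ^ d\<close> are nonnegative, and the
  left side is the one with \<open>j = 1\<close>.\<close>

lemma card_mprimes_le: "d * card (mprimes d :: 'a::finite_field poly set) \<le> CARD('a) ^ d"
proof (cases "d = 0")
  case False
  let ?f = "\<lambda>e j. if j * e = d then e * card (mprimes e :: 'a poly set) else 0"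
  have "d * card (mprimes d :: 'a poly set) = ?f d 1" by simp
  also have "\<dots> \<le> (\<Sum>j\<in>{1..d}. ?f d j)"
    by (rule member_le_sum[where i = 1]) (use False in auto)
  also have "\<dots> \<le> (\<Sum>e\<in>{1..d}. \<Sum>j\<in>{1..d}. ?f e j)"
    by (rule member_le_sum[where i = d]) (use False in auto)
  also have "\<dots> = CARD('a) ^ d" using False by (intro sum_mprimes_eq_power) auto
  finally show ?thesis .
qed simp

lemma card_mprimes_div_le: "real d * real (card (mprimes d :: 'a::finite_field poly set)) / real CARD('a) ^ d \<le> 1"
proof -
  have "real (d * card (mprimes d :: 'a poly set)) \<le> real (CARD('a) ^ d)"
    using card_mprimes_le of_nat_mono by blast
  then show ?thesis by (simp add: field_simps)
qed

lemma card_monic_multiples_le: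
  fixes D :: "'a::finite_field poly"
  assumes "D \<in> monics e"
  shows "real (card {A \<in> monics n. D dvd A}) \<le> real CARD('a) ^ n / real CARD('a) ^ e"
  by (simp add: card_monic_multiples[OF assms] power_diff[of "real CARD('a)"])

lemma two_le_card_field: "2 \<le> CARD('a::finite_field)"
proof -
  have "card {0, 1 :: 'a} \<le> CARD('a)" by (intro card_mono) auto
  then show ?thesis by simp
qed

text \<open>A geometric series with ratio at most 1/2 is at most twice its first term.\<close>

lemma sum_inverse_powers_le:
  assumes "1 \<le> d"
  shows "(\<Sum>j\<in>{1..N}. 1 / real CARD('a::finite_field) ^ (j * d)) \<le> 2 / real CARD('a) ^ d"
proof -
  let ?q = "real CARD('a)"
  define x where "x = 1 / ?q ^ d"
  have "2 ^ 1 \<le> (2 :: real) ^ d" using assms by (intro power_increasing) auto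
  also have "\<dots> \<le> ?q ^ d" using two_le_card_field[where 'a = 'a] by (intro power_mono) auto
  finally have x: "0 \<le> x" "2 * x \<le> 1" by (auto simp: x_def field_simps)
  \<comment> \<open>The extra summand dominates the tail of the series and makes the induction
    close: the step needs only \<open>2 * x \<le> 1\<close>.\<close>
  have "(\<Sum>j\<in>{1..N}. x ^ j) + 2 * x * x ^ N \<le> 2 * x"
  proof (induction N)
    case (Suc N)
    have "2 * x * x ^ Suc N \<le> x ^ Suc N"
      using mult_right_mono[OF x(2), of "x ^ Suc N"] x(1) by simp
    then show ?case using Suc by (simp add: algebra_simps)
  qed simp
  moreover have "0 \<le> 2 * x * x ^ N" using x by simp
  ultimately have "(\<Sum>j\<in>{1..N}. x ^ j) \<le> 2 * x" by linarith
  moreover have "x ^ j = 1 / ?q ^ (j * d)" for j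
    by (simp add: x_def power_mult[symmetric] power_one_over mult.commute)
  ultimately show ?thesis by (simp add: x_def)
qed

text \<open>Each degree \<open>d\<close> contributes at most 2: the weighted number of primes is at
  most \<open>CARD('a) ^ d\<close>, and the sum over \<open>j\<close> costs a factor 2.\<close>

lemma sum_small_mprimes_le:
  "(\<Sum>d | d \<in> {1..N} \<and> d \<le> M. \<Sum>P\<in>(mprimes d :: 'a::finite_field poly set). \<Sum>j\<in>{1..N}.
      real d / real CARD('a) ^ (j * d)) \<le> 2 * real M"
proof -
  let ?q = "real CARD('a)" and ?\<pi> = "\<lambda>d. real (card (mprimes d :: 'a poly set))"
  have "(\<Sum>P\<in>(mprimes d :: 'a poly set). \<Sum>j\<in>{1..N}. real d / ?q ^ (j * d)) \<le> 2"
    if "1 \<le> d" for d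
  proof -
    have "(\<Sum>P\<in>(mprimes d :: 'a poly set). \<Sum>j\<in>{1..N}. real d / ?q ^ (j * d))
        = real d * ?\<pi> d * (\<Sum>j\<in>{1..N}. 1 / ?q ^ (j * d))"
      by (simp add: sum_distrib_left mult_ac)
    also have "\<dots> \<le> real d * ?\<pi> d * (2 / ?q ^ d)"
      by (intro mult_left_mono sum_inverse_powers_le that) auto
    also have "\<dots> = 2 * (real d * ?\<pi> d / ?q ^ d)" by simp
    also have "\<dots> \<le> 2 * 1" by (intro mult_left_mono card_mprimes_div_le) auto
    finally show ?thesis by simp
  qed
  then have "(\<Sum>d | d \<in> {1..N} \<and> d \<le> M. \<Sum>P\<in>(mprimes d :: 'a poly set). \<Sum>j\<in>{1..N}.
      real d / ?q ^ (j * d)) \<le> (\<Sum>d | d \<in> {1..N} \<and> d \<le> M. 2)"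
    by (intro sum_mono) auto
  also have "\<dots> = 2 * real (card {d \<in> {1..N}. d \<le> M})" by simp
  also have "card {d \<in> {1..N}. d \<le> M} \<le> card {1..M}" by (intro card_mono) auto
  finally show ?thesis by simp
qed

section \<open>The density of smooth polynomials\<close>

definition smooth :: "nat \<Rightarrow> nat \<Rightarrow> 'a::field poly set" where
  "smooth M k = {A \<in> monics k. \<forall>d>M. \<forall>P\<in>mprimes d. \<not> P dvd A}"

text \<open>Summed over \<open>k\<close>, this gives the sum of
  \<open>CARD('a) ^ (- degree B)\<close> over the smooth \<open>B\<close>.\<close>

definition smooth_density :: "'a::finite_field itself \<Rightarrow> nat \<Rightarrow> nat \<Rightarrow> real" where
  "smooth_density F M k = real (card (smooth M k :: 'a poly set)) / real CARD('a) ^ k"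

lemma finite_smooth [simp]: "finite (smooth M k :: 'a::finite_field poly set)"
  by (rule finite_subset[OF _ finite_monics[of k]]) (auto simp: smooth_def)

lemma smooth_density_nonneg [simp]: "0 \<le> smooth_density F M k"
  by (simp add: smooth_density_def)

lemma smooth_density_le_1: "smooth_density TYPE('a::finite_field) M k \<le> 1"
proof -
  have "card (smooth M k :: 'a poly set) \<le> CARD('a) ^ k"
    unfolding card_monics[symmetric] by (intro card_mono) (auto simp: smooth_def)
  then have "real (card (smooth M k :: 'a poly set)) \<le> real (CARD('a) ^ k)"
    using of_nat_mono by blast
  then show ?thesis by (simp add: smooth_density_def field_simps)
qed

text \<open>The weighted count is applied to the smooth polynomials of degree \<open>k\<close>.
  Primes of degree above \<open>M\<close> contribute nothing, and the cofactor of
  \<open>P ^ j\<close> in a smooth polynomial is again smooth.\<close>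

lemma smooth_density_weighted_le:
  assumes "k \<le> N"
  shows "real k * smooth_density TYPE('a::finite_field) M k
    \<le> (\<Sum>d | d \<in> {1..N} \<and> d \<le> M. \<Sum>P\<in>(mprimes d :: 'a poly set). \<Sum>j\<in>{1..N}.
        real d / real CARD('a) ^ (j * d) *
        (if j * d \<le> k then smooth_density TYPE('a) M (k - j * d) else 0))"
    (is "_ \<le> (\<Sum>d | _. \<Sum>P\<in>_. \<Sum>j\<in>_. ?f d j)")
proof -
  let ?S = "smooth M k :: 'a poly set" and ?q = "real CARD('a)"
  have large: "{A \<in> ?S. P ^ j dvd A} = {}" if "P \<in> mprimes d" "d > M" "j \<in> {1..N}" for P d j
  proof -
    have "P dvd P ^ j" using that by (intro dvd_power) auto
    then show ?thesis using that unfolding smooth_def by (blast intro: dvd_trans)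
  qed
  have small: "real d * card {A \<in> ?S. P ^ j dvd A} / ?q ^ k \<le> ?f d j"
    if "P \<in> mprimes d" for P d j
  proof (cases "j * d \<le> k")
    case True
    have "card {A \<in> ?S. P ^ j dvd A} = card {B \<in> monics (k - j * d). P ^ j * B \<in> ?S}"
      using True by (subst card_multiples[OF monics_power[OF mprimesD(4)[OF that]], of _ k])
        (auto simp: smooth_def)
    also have "\<dots> \<le> card (smooth M (k - j * d) :: 'a poly set)"
      by (intro card_mono) (auto simp: smooth_def dest: dvd_mult)
    finally have "real d * card {A \<in> ?S. P ^ j dvd A} / ?q ^ k
        \<le> real d * card (smooth M (k - j * d) :: 'a poly set) / ?q ^ k"
      by (intro divide_right_mono mult_left_mono) auto
    also have "\<dots> = ?f d j"
      using True by (simp add: smooth_density_def power_diff[of ?q])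
    finally show ?thesis .
  next
    case False
    then have *: "card {A \<in> ?S. P ^ j dvd A} = 0"
      by (subst card_multiples[OF monics_power[OF mprimesD(4)[OF that]], of _ k])
        (auto simp: smooth_def)
    show ?thesis using False unfolding * by simp
  qed
  have "k * card ?S = (\<Sum>d\<in>{1..N}. \<Sum>P\<in>mprimes d. \<Sum>j\<in>{1..N}. d * card {A \<in> ?S. P ^ j dvd A})"
    by (rule degree_weighted_count) (use assms in \<open>auto simp: smooth_def\<close>)
  also have "\<dots> = (\<Sum>d | d \<in> {1..N} \<and> d \<le> M. \<Sum>P\<in>mprimes d. \<Sum>j\<in>{1..N}. d * card {A \<in> ?S. P ^ j dvd A})"
    by (intro sum.mono_neutral_right ballI sum.neutral) (use large in auto)
  finally have "real k * smooth_density TYPE('a) M k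
      = real (\<Sum>d | d \<in> {1..N} \<and> d \<le> M. \<Sum>P\<in>mprimes d. \<Sum>j\<in>{1..N}. d * card {A \<in> ?S. P ^ j dvd A}) / ?q ^ k"
    unfolding smooth_density_def by (simp flip: of_nat_mult)
  also have "\<dots> = (\<Sum>d | d \<in> {1..N} \<and> d \<le> M. \<Sum>P\<in>mprimes d. \<Sum>j\<in>{1..N}.
      real d * card {A \<in> ?S. P ^ j dvd A} / ?q ^ k)"
    by (simp only: of_nat_sum of_nat_mult sum_divide_distrib)
  also have "\<dots> \<le> (\<Sum>d | d \<in> {1..N} \<and> d \<le> M. \<Sum>P\<in>(mprimes d :: 'a poly set). \<Sum>j\<in>{1..N}. ?f d j)"
    by (intro sum_mono small)
  finally show ?thesis .
qed

lemma sum_shift_le: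
  fixes u :: "nat \<Rightarrow> real"
  assumes "\<And>k. 0 \<le> u k"
  shows "(\<Sum>k\<in>{..n}. if i \<le> k then u (k - i) else 0) \<le> (\<Sum>k\<in>{..n}. u k)"
proof -
  have "(\<Sum>k\<in>{..n}. if i \<le> k then u (k - i) else 0) = (\<Sum>k\<in>{i..n}. u (k - i))"
    by (rule sum.mono_neutral_cong_right) auto
  also have "\<dots> = sum u ((\<lambda>k. k - i) ` {i..n})"
    by (subst sum.reindex) (auto simp: inj_on_def)
  also have "\<dots> \<le> sum u {..n}"
    using assms by (intro sum_mono2) auto
  finally show ?thesis .
qed

text \<open>Summing over \<open>k\<close> turns the right side of
  \<open>smooth_density_weighted_le\<close> into shifted copies of the sum of densities. Each copy
  is at most the full sum, and their weights add up to at most \<open>2 * M\<close>.\<close>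

lemma sum_weighted_smooth_density_le:
  "(\<Sum>k\<in>{..n}. real k * smooth_density TYPE('a::finite_field) M k)
    \<le> 2 * real M * (\<Sum>k\<in>{..n}. smooth_density TYPE('a) M k)"
proof -
  let ?u = "smooth_density TYPE('a) M" and ?q = "real CARD('a)"
  let ?D = "{d. d \<in> {1..n} \<and> d \<le> M}" and ?P = "\<lambda>d. mprimes d :: 'a poly set"
  have "(\<Sum>k\<in>{..n}. real k * ?u k) \<le> (\<Sum>k\<in>{..n}. \<Sum>d\<in>?D. \<Sum>P\<in>?P d. \<Sum>j\<in>{1..n}.
        real d / ?q ^ (j * d) * (if j * d \<le> k then ?u (k - j * d) else 0))"
    by (intro sum_mono smooth_density_weighted_le) simp
  also have "\<dots> = (\<Sum>d\<in>?D. \<Sum>P\<in>?P d. \<Sum>j\<in>{1..n}. \<Sum>k\<in>{..n}.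
        real d / ?q ^ (j * d) * (if j * d \<le> k then ?u (k - j * d) else 0))"
    by (simp only: sum.swap[of _ _ "{..n}"])
  also have "\<dots> \<le> (\<Sum>d\<in>?D. \<Sum>P\<in>?P d. \<Sum>j\<in>{1..n}. real d / ?q ^ (j * d) * (\<Sum>k\<in>{..n}. ?u k))"
    unfolding sum_distrib_left[symmetric]
    by (intro sum_mono mult_left_mono sum_shift_le) auto
  also have "\<dots> = (\<Sum>d\<in>?D. \<Sum>P\<in>?P d. \<Sum>j\<in>{1..n}. real d / ?q ^ (j * d)) * (\<Sum>k\<in>{..n}. ?u k)"
    by (simp only: sum_distrib_right)
  also have "\<dots> \<le> 2 * real M * (\<Sum>k\<in>{..n}. ?u k)"
    by (intro mult_right_mono sum_small_mprimes_le sum_nonneg) auto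
  finally show ?thesis .
qed

text \<open>
  The weighted inequality above shows that at least half of the sum comes from the terms
  \<open>k \<le> 4 * M\<close>. This replaces Mertens' theorem for the Euler product over \<open>deg P \<le> M\<close>.
\<close>
lemma sum_smooth_density_le:
  "(\<Sum>k\<in>{..n}. smooth_density TYPE('a::finite_field) M k) \<le> 8 * real M + 2"
proof -
  let ?u = "smooth_density TYPE('a) M"
  \<comment> \<open>The value \<open>4 * M + 1\<close> plays three roles: it is the number of all
    \<open>k \<le> 4 * M\<close>, a lower bound for every other \<open>k\<close>, and at least twice
    the factor \<open>2 * M\<close> of the weighted inequality, so that half of
    \<open>?c * ?U\<close> can be absorbed.\<close>
  let ?U = "\<Sum>k\<in>{..n}. ?u k" and ?c = "4 * real M + 1"
  have U: "0 \<le> ?U" by (intro sum_nonneg) simp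
  have "?c * ?U = (\<Sum>k\<in>{..n}. ?c * ?u k)" by (simp only: sum_distrib_left)
  also have "\<dots> \<le> (\<Sum>k\<in>{..n}. (if k \<le> 4 * M then ?c else 0) + real k * ?u k)"
  proof (intro sum_mono)
    fix k
    show "?c * ?u k \<le> (if k \<le> 4 * M then ?c else 0) + real k * ?u k"
    proof (cases "k \<le> 4 * M")
      case True
      have "?c * ?u k \<le> ?c * 1" by (intro mult_left_mono smooth_density_le_1) auto
      then show ?thesis using True by (simp add: add_increasing2)
    next
      case False
      then have "?c \<le> real k" by linarith
      then show ?thesis using False by (simp add: mult_right_mono)
    qed
  qed
  also have "\<dots> = ?c * real (card {k \<in> {..n}. k \<le> 4 * M}) + (\<Sum>k\<in>{..n}. real k * ?u k)"
    by (simp add: sum.distrib sum.If_cases Int_def)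
  also have "\<dots> \<le> ?c * ?c + 2 * real M * ?U"
  proof (intro add_mono mult_left_mono sum_weighted_smooth_density_le)
    have "card {k \<in> {..n}. k \<le> 4 * M} \<le> card {..4 * M}" by (intro card_mono) auto
    then show "real (card {k \<in> {..n}. k \<le> 4 * M}) \<le> ?c" by simp
  qed simp
  also have "\<dots> \<le> ?c * ?c + ?c / 2 * ?U"
    using U by (intro add_left_mono mult_right_mono) auto
  finally have "?c * ?U \<le> ?c * (2 * ?c)" by (simp add: field_simps)
  then have "?U \<le> 2 * ?c" by (rule mult_left_le_imp_le) simp
  then show ?thesis by simp
qed

section \<open>Polynomials whose second largest prime degree is small\<close>

text \<open>Since \<open>a < b\<close>, the degree \<open>a\<close> is not the maximum and survives
  its removal.\<close>

lemma le_Delta2: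
  assumes "A \<noteq> 0" "a \<in> prime_degrees A" "b \<in> prime_degrees A" "a < b"
  shows "a \<le> Delta2 A"
proof -
  let ?N = "prime_degrees A"
  have fin: "finite ?N" using finite_prime_degrees[OF assms(1)] .
  have "card {a, b} \<le> card ?N" using assms fin by (intro card_mono) auto
  then have "\<not> card ?N < 2" using assms(4) by simp
  moreover have "b \<le> Max ?N" using fin assms(3) by simp
  then have "a \<in> ?N - {Max ?N}" using assms by auto
  then have "a \<le> Max (?N - {Max ?N})" using fin by simp
  ultimately show ?thesis by (simp add: Delta2_def)
qed

text \<open>Of two distinct prime degrees the smaller is at most \<open>Delta2 A\<close>, hence at
  most \<open>M\<close>.\<close>

lemma degrees_eq_if_Delta2_le:
  assumes "A \<noteq> 0" "Delta2 A \<le> M" "P \<in> mprimes d" "Q \<in> mprimes e" "P dvd A" "Q dvd A" "M < d" "M < e"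
  shows "d = e"
proof -
  have "d \<in> prime_degrees A" "e \<in> prime_degrees A"
    using assms by (auto simp: prime_degrees_def mprimes_def)
  then show ?thesis
    using le_Delta2[OF assms(1), of d e] le_Delta2[OF assms(1), of e d] assms by linarith
qed

text \<open>The cofactor of \<open>P ^ j\<close> is either smooth or divisible by a prime
  \<open>Q\<close> of degree above \<open>M\<close>, and then \<open>Q\<close> has degree
  \<open>d\<close> by \<open>degrees_eq_if_Delta2_le\<close>. The second summand is the union bound
  over such \<open>Q\<close>, with \<open>Q = P\<close> included.\<close>

lemma card_Delta2_multiples_le:
  fixes P :: "'a::finite_field poly"
  assumes P: "P \<in> mprimes d" and "M < d" "1 \<le> j"
  shows "real (card {A \<in> monics n. Delta2 A \<le> M \<and> P ^ j dvd A})
    \<le> (if j * d \<le> n then real (card (smooth M (n - j * d) :: 'a poly set)) else 0)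
      + real (card (mprimes d :: 'a poly set)) * (real CARD('a) ^ n / (real CARD('a) ^ (j * d) * real CARD('a) ^ d))"
proof (cases "j * d \<le> n")
  case True
  let ?q = "real CARD('a)"
  let ?S = "{A \<in> monics n. Delta2 A \<le> M} :: 'a poly set"
  let ?R = "\<lambda>Q :: 'a poly. {B \<in> monics (n - j * d). Q dvd B}"
  have sub: "{B \<in> monics (n - j * d). P ^ j * B \<in> ?S} \<subseteq> smooth M (n - j * d) \<union> (\<Union>Q\<in>mprimes d. ?R Q)"
  proof
    fix B assume B: "B \<in> {B \<in> monics (n - j * d). P ^ j * B \<in> ?S}"
    have "e = d" if "Q \<in> mprimes e" "M < e" "Q dvd B" for Q e
    proof (rule degrees_eq_if_Delta2_le[of "P ^ j * B" M Q e P d])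
      show "P ^ j * B \<noteq> 0" using B by (intro monicsD(3)[of _ n]) auto
      show "P dvd P ^ j * B" using \<open>1 \<le> j\<close> by (intro dvd_mult2 dvd_power) auto
    qed (use B that assms in auto)
    then show "B \<in> smooth M (n - j * d) \<union> (\<Union>Q\<in>mprimes d. ?R Q)"
      using B by (auto simp: smooth_def)
  qed
  have "{A \<in> monics n. Delta2 A \<le> M \<and> P ^ j dvd A} = {A \<in> ?S. P ^ j dvd A}" by auto
  then have "card {A \<in> monics n. Delta2 A \<le> M \<and> P ^ j dvd A} = card {B \<in> monics (n - j * d). P ^ j * B \<in> ?S}"
    using True card_multiples[OF monics_power[OF mprimesD(4)[OF P]], of ?S n j] by simp
  also have "\<dots> \<le> card (smooth M (n - j * d) \<union> (\<Union>Q\<in>mprimes d. ?R Q))"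
    by (intro card_mono sub) auto
  also have "\<dots> \<le> card (smooth M (n - j * d) :: 'a poly set) + card (\<Union>Q\<in>mprimes d. ?R Q)"
    by (rule card_Un_le)
  also have "card (\<Union>Q\<in>mprimes d. ?R Q) \<le> (\<Sum>Q\<in>mprimes d. card (?R Q))"
    by (intro card_UN_le) simp
  finally have "real (card {A \<in> monics n. Delta2 A \<le> M \<and> P ^ j dvd A})
      \<le> real (card (smooth M (n - j * d) :: 'a poly set)) + (\<Sum>Q\<in>mprimes d. real (card (?R Q)))"
    by (simp flip: of_nat_sum of_nat_add)
  also have "(\<Sum>Q\<in>mprimes d. real (card (?R Q))) \<le> (\<Sum>Q\<in>(mprimes d :: 'a poly set). ?q ^ (n - j * d) / ?q ^ d)"
    by (intro sum_mono card_monic_multiples_le mprimesD(4))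
  finally show ?thesis using True by (simp add: power_diff[of ?q])
next
  case False
  have "{A \<in> monics n. Delta2 A \<le> M \<and> P ^ j dvd A} \<subseteq> {A \<in> monics n. P ^ j dvd A}" by auto
  moreover have "{A \<in> monics n. P ^ j dvd A} = {}"
    using False monics_cancel(1)[OF monics_power[OF mprimesD(4)[OF P]]] by (auto simp: dvd_def)
  ultimately have *: "{A \<in> monics n. Delta2 A \<le> M \<and> P ^ j dvd A} = {}" by blast
  show ?thesis using False unfolding * by simp
qed

text \<open>Grouping by \<open>r = j * d\<close> makes the exact value of
  \<open>sum_mprimes_eq_power\<close> available: prime powers of degree \<open>r\<close> have total
  weight \<open>CARD('a) ^ r\<close>, which turns the number of smooth cofactors of degree
  \<open>n - r\<close> into their density times \<open>CARD('a) ^ n\<close>.\<close>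

lemma sum_smooth_cofactor_le:
  "(\<Sum>d\<in>{1..n}. \<Sum>P\<in>(mprimes d :: 'a::finite_field poly set). \<Sum>j\<in>{1..n}.
      real d * (if j * d \<le> n then real (card (smooth M (n - j * d) :: 'a poly set)) else 0))
    \<le> real CARD('a) ^ n * (\<Sum>k\<in>{..n}. smooth_density TYPE('a) M k)"
proof -
  let ?q = "real CARD('a)" and ?s = "\<lambda>k. real (card (smooth M k :: 'a poly set))"
  let ?\<pi> = "\<lambda>d. card (mprimes d :: 'a poly set)"
  \<comment> \<open>The inner sum over \<open>r\<close> has at most one nonzero term, at
    \<open>r = j * d\<close>; it is empty of nonzero terms exactly when the condition
    \<open>j * d \<le> n\<close> fails or no prime has degree \<open>d\<close> or the smooth count
    vanishes.\<close>
  have "(\<Sum>P\<in>(mprimes d :: 'a poly set). \<Sum>j\<in>{1..n}. real d * (if j * d \<le> n then ?s (n - j * d) else 0))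
      = (\<Sum>j\<in>{1..n}. \<Sum>r\<in>{1..n}. ?s (n - r) * (if j * d = r then d * ?\<pi> d else 0))"
    if "d \<in> {1..n}" for d
    using that
    by (subst sum.swap, intro sum.cong refl)
       (auto simp: if_distrib[of "\<lambda>x. _ * x"] if_distrib[of real] sum.delta cong: if_cong)
  then have "(\<Sum>d\<in>{1..n}. \<Sum>P\<in>(mprimes d :: 'a poly set). \<Sum>j\<in>{1..n}.
        real d * (if j * d \<le> n then ?s (n - j * d) else 0))
      = (\<Sum>d\<in>{1..n}. \<Sum>j\<in>{1..n}. \<Sum>r\<in>{1..n}. ?s (n - r) * (if j * d = r then d * ?\<pi> d else 0))"
    by (intro sum.cong refl)
  also have "\<dots> = (\<Sum>d\<in>{1..n}. \<Sum>r\<in>{1..n}. \<Sum>j\<in>{1..n}. ?s (n - r) * (if j * d = r then d * ?\<pi> d else 0))"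
    by (intro sum.cong refl sum.swap)
  also have "\<dots> = (\<Sum>r\<in>{1..n}. \<Sum>d\<in>{1..n}. \<Sum>j\<in>{1..n}. ?s (n - r) * (if j * d = r then d * ?\<pi> d else 0))"
    by (rule sum.swap)
  also have "\<dots> = (\<Sum>r\<in>{1..n}. ?s (n - r) * real (\<Sum>d\<in>{1..n}. \<Sum>j\<in>{1..n}. if j * d = r then d * ?\<pi> d else 0))"
    by (simp only: sum_distrib_left of_nat_sum)
  also have "\<dots> = (\<Sum>r\<in>{1..n}. ?s (n - r) * ?q ^ r)"
    by (intro sum.cong refl, subst sum_mprimes_eq_power) auto
  also have "\<dots> = ?q ^ n * (\<Sum>r\<in>{1..n}. smooth_density TYPE('a) M (n - r))"
    unfolding sum_distrib_left
    by (intro sum.cong refl) (auto simp: smooth_density_def power_diff[of ?q])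
  also have "(\<Sum>r\<in>{1..n}. smooth_density TYPE('a) M (n - r)) = sum (smooth_density TYPE('a) M) ((\<lambda>r. n - r) ` {1..n})"
    by (subst sum.reindex) (auto simp: inj_on_def)
  also have "\<dots> \<le> (\<Sum>k\<in>{..n}. smooth_density TYPE('a) M k)"
    by (intro sum_mono2) auto
  finally show ?thesis by (simp add: mult_left_mono)
qed

text \<open>For each \<open>d\<close> there are two primes to choose, each in at most
  \<open>CARD('a) ^ d / d\<close> ways. With the weight \<open>d\<close> this leaves
  \<open>1 / d\<close>, and the geometric series over \<open>j\<close> gives the factor 2.\<close>

lemma sum_mprime_pairs_le:
  "(\<Sum>d\<in>{1..n}. \<Sum>P\<in>(mprimes d :: 'a::finite_field poly set). \<Sum>j\<in>{1..n}.
      real d * (real (card (mprimes d :: 'a poly set)) * (real CARD('a) ^ n / (real CARD('a) ^ (j * d) * real CARD('a) ^ d))))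
    \<le> 2 * real CARD('a) ^ n * (\<Sum>d\<in>{1..n}. 1 / real d)"
  unfolding sum_distrib_left
proof (intro sum_mono)
  fix d assume d: "d \<in> {1..n}"
  let ?q = "real CARD('a)" and ?\<pi> = "real (card (mprimes d :: 'a poly set))"
  have "(\<Sum>P\<in>(mprimes d :: 'a poly set). \<Sum>j\<in>{1..n}. real d * (?\<pi> * (?q ^ n / (?q ^ (j * d) * ?q ^ d))))
      = real d * ?\<pi> * ?\<pi> * ?q ^ n / ?q ^ d * (\<Sum>j\<in>{1..n}. 1 / ?q ^ (j * d))"
    by (simp add: sum_distrib_left sum_divide_distrib mult_ac)
  also have "\<dots> \<le> real d * ?\<pi> * ?\<pi> * ?q ^ n / ?q ^ d * (2 / ?q ^ d)"
    using d by (intro mult_left_mono sum_inverse_powers_le) auto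
  also have "\<dots> = 2 * ?q ^ n * (1 / real d) * ((real d * ?\<pi> / ?q ^ d) * (real d * ?\<pi> / ?q ^ d))"
    using d by (simp add: field_simps)
  also have "\<dots> \<le> 2 * ?q ^ n * (1 / real d) * (1 * 1)"
    by (intro mult_left_mono mult_mono card_mprimes_div_le) auto
  finally show "(\<Sum>P\<in>(mprimes d :: 'a poly set). \<Sum>j\<in>{1..n}. real d * (?\<pi> * (?q ^ n / (?q ^ (j * d) * ?q ^ d))))
      \<le> 2 * ?q ^ n * (1 / real d)" by simp
qed

text \<open>Degrees \<open>d \<le> M\<close> give \<open>2 * M\<close>, smooth cofactors give
  \<open>8 * M + 2\<close>, and pairs of primes of equal degree give the harmonic sum.\<close>

lemma card_Delta2_le:
  "real n * card {A \<in> monics n :: 'a::finite_field poly set. Delta2 A \<le> M}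
    \<le> real CARD('a) ^ n * (10 * real M + 2 + 2 * (\<Sum>d\<in>{1..n}. 1 / real d))"
proof -
  let ?q = "real CARD('a)" and ?P = "\<lambda>d. mprimes d :: 'a poly set"
  let ?S = "{A \<in> monics n. Delta2 A \<le> M} :: 'a poly set"
  let ?lo = "{d. d \<in> {1..n} \<and> d \<le> M}" and ?hi = "{d. d \<in> {1..n} \<and> M < d}"
  let ?s = "\<lambda>d j. if j * d \<le> n then real (card (smooth M (n - j * d) :: 'a poly set)) else 0"
  let ?t = "\<lambda>d j. real (card (?P d)) * (?q ^ n / (?q ^ (j * d) * ?q ^ d))"
  define c where "c P j = real (card {A \<in> ?S. P ^ j dvd A})" for P j
  have split: "real (n * card ?S) = (\<Sum>d\<in>?lo. \<Sum>P\<in>?P d. \<Sum>j\<in>{1..n}. real d * c P j)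
      + (\<Sum>d\<in>?hi. \<Sum>P\<in>?P d. \<Sum>j\<in>{1..n}. real d * c P j)"
  proof -
    have "real (n * card ?S) = (\<Sum>d\<in>{1..n}. \<Sum>P\<in>?P d. \<Sum>j\<in>{1..n}. real d * c P j)"
      unfolding c_def by (subst degree_weighted_count[of _ n n]) auto
    then show ?thesis
      by (subst sum.union_disjoint[symmetric]) (auto intro!: sum.cong)
  qed
  have lo: "(\<Sum>d\<in>?lo. \<Sum>P\<in>?P d. \<Sum>j\<in>{1..n}. real d * c P j) \<le> ?q ^ n * (2 * real M)"
  proof -
    have "real d * c P j \<le> ?q ^ n * (real d / ?q ^ (j * d))" if "P \<in> ?P d" for d P j
    proof -
      have "c P j \<le> real (card {A \<in> monics n. P ^ j dvd A})"
        unfolding c_def by (intro of_nat_mono card_mono) auto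
      also have "\<dots> \<le> ?q ^ n / ?q ^ (j * d)"
        by (intro card_monic_multiples_le monics_power mprimesD(4) that)
      finally have "real d * c P j \<le> real d * (?q ^ n / ?q ^ (j * d))"
        by (intro mult_left_mono) auto
      then show ?thesis by (simp add: mult.commute)
    qed
    then have "(\<Sum>d\<in>?lo. \<Sum>P\<in>?P d. \<Sum>j\<in>{1..n}. real d * c P j)
        \<le> (\<Sum>d\<in>?lo. \<Sum>P\<in>?P d. \<Sum>j\<in>{1..n}. ?q ^ n * (real d / ?q ^ (j * d)))"
      by (intro sum_mono)
    also have "\<dots> = ?q ^ n * (\<Sum>d\<in>?lo. \<Sum>P\<in>?P d. \<Sum>j\<in>{1..n}. real d / ?q ^ (j * d))"
      by (simp only: sum_distrib_left)
    also have "\<dots> \<le> ?q ^ n * (2 * real M)"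
      by (intro mult_left_mono sum_small_mprimes_le) simp
    finally show ?thesis .
  qed
  have hi: "(\<Sum>d\<in>?hi. \<Sum>P\<in>?P d. \<Sum>j\<in>{1..n}. real d * c P j)
      \<le> ?q ^ n * (8 * real M + 2) + 2 * ?q ^ n * (\<Sum>d\<in>{1..n}. 1 / real d)"
  proof -
    have "real d * c P j \<le> real d * (?s d j + ?t d j)"
      if "d \<in> ?hi" "P \<in> ?P d" "j \<in> {1..n}" for d P j
      using card_Delta2_multiples_le[of P d M j n] that
      by (intro mult_left_mono) (simp_all add: c_def conj_assoc)
    then have "(\<Sum>d\<in>?hi. \<Sum>P\<in>?P d. \<Sum>j\<in>{1..n}. real d * c P j)
        \<le> (\<Sum>d\<in>?hi. \<Sum>P\<in>?P d. \<Sum>j\<in>{1..n}. real d * (?s d j + ?t d j))"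
      by (intro sum_mono)
    \<comment> \<open>The range is enlarged to all degrees because the exact count of prime powers
      of a given degree involves every \<open>d\<close>.\<close>
    also have "\<dots> \<le> (\<Sum>d\<in>{1..n}. \<Sum>P\<in>?P d. \<Sum>j\<in>{1..n}. real d * (?s d j + ?t d j))"
      by (intro sum_mono2 sum_nonneg) auto
    also have "\<dots> = (\<Sum>d\<in>{1..n}. \<Sum>P\<in>?P d. \<Sum>j\<in>{1..n}. real d * ?s d j)
        + (\<Sum>d\<in>{1..n}. \<Sum>P\<in>?P d. \<Sum>j\<in>{1..n}. real d * ?t d j)"
      by (simp only: distrib_left sum.distrib)
    also have "\<dots> \<le> ?q ^ n * (\<Sum>k\<in>{..n}. smooth_density TYPE('a) M k)
        + 2 * ?q ^ n * (\<Sum>d\<in>{1..n}. 1 / real d)"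
      by (intro add_mono sum_smooth_cofactor_le sum_mprime_pairs_le)
    also have "\<dots> \<le> ?q ^ n * (8 * real M + 2) + 2 * ?q ^ n * (\<Sum>d\<in>{1..n}. 1 / real d)"
      by (intro add_mono mult_left_mono sum_smooth_density_le) auto
    finally show ?thesis .
  qed
  have "real n * real (card ?S)
      \<le> ?q ^ n * (2 * real M) + (?q ^ n * (8 * real M + 2) + 2 * ?q ^ n * (\<Sum>d\<in>{1..n}. 1 / real d))"
    using split lo hi by simp
  also have "\<dots> = ?q ^ n * (10 * real M + 2 + 2 * (\<Sum>d\<in>{1..n}. 1 / real d))"
    by (simp add: algebra_simps)
  finally show ?thesis .
qed

section \<open>The harmonic sum and the final estimate\<close>

lemma sum_inverse_le_ln: "1 \<le> n \<Longrightarrow> (\<Sum>d\<in>{1..n}. 1 / real d) \<le> 1 + ln (real n)"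
proof (induction n rule: dec_induct)
  case (step n)
  have "ln (real n / real (Suc n)) \<le> real n / real (Suc n) - 1"
    using step.hyps by (intro ln_le_minus_one) auto
  also have "\<dots> = - (1 / real (Suc n))" by (simp add: field_simps)
  finally have "1 / real (Suc n) \<le> ln (real (Suc n)) - ln (real n)"
    using step.hyps by (simp add: ln_div)
  then show ?case using step.IH by simp
qed simp

theorem theorem2p2:
  fixes q :: nat and \<epsilon> :: real
  assumes "q = card (UNIV :: 'a::finite_field set)"
    and "0 < \<epsilon>" and "\<epsilon> < 1"
  shows "\<exists>C>0. \<forall>m :: nat \<Rightarrow> real.
           (\<forall>n\<ge>1. m n > 0) \<longrightarrow> m \<in> o(\<lambda>n. real n) \<longrightarrow>
           (\<forall>n\<ge>1. real (Psi2 TYPE('a) n (m n))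
                    \<le> C * (real q ^ n / real n powr \<epsilon> + real q ^ n * (m n / real n)))"
proof -
  \<comment> \<open>The 10 is the coefficient of \<open>M\<close> in \<open>card_Delta2_le\<close>
    and also covers the additive constant 4; \<open>2 / (1 - \<epsilon>)\<close> comes from bounding
    \<open>2 * ln n\<close> by a multiple of \<open>n powr (1 - \<epsilon>)\<close>.\<close>
  define C where "C = 10 + 2 / (1 - \<epsilon>)"
  have C: "C > 10" using assms by (simp add: C_def)
  have bound: "real (Psi2 TYPE('a) n x) \<le> C * (real q ^ n / real n powr \<epsilon> + real q ^ n * (x / real n))"
    if n: "1 \<le> n" and x: "0 < x" for n x
  proof -
    \<comment> \<open>\<open>Delta2\<close> takes natural values, so the real threshold
      \<open>x\<close> can be replaced by its floor.\<close>
    define M where "M = nat \<lfloor>x\<rfloor>"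
    have M: "real M \<le> x" using x by (simp add: M_def)
    have "real k \<le> x \<longleftrightarrow> k \<le> M" for k
      using x by (simp add: M_def le_nat_floor le_floor_iff nat_le_iff le_nat_iff)
    then have "Psi2 TYPE('a) n x = card {A \<in> monics n :: 'a poly set. Delta2 A \<le> M}"
      by (simp add: Psi2_def monics_def conj_assoc)
    then have "real n * Psi2 TYPE('a) n x
        \<le> real q ^ n * (10 * real M + 2 + 2 * (\<Sum>d\<in>{1..n}. 1 / real d))"
      using card_Delta2_le[of n M, where 'a = 'a] assms(1) by simp
    also have "\<dots> \<le> real q ^ n * (10 * x + 4 + 2 * ln (real n))"
      using M sum_inverse_le_ln[OF n] by (intro mult_left_mono) auto
    also have "\<dots> \<le> real q ^ n * (C * x + C * real n powr (1 - \<epsilon>))"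
    proof (intro mult_left_mono)
      have "ln (real n) \<le> real n powr (1 - \<epsilon>) / (1 - \<epsilon>)"
        using n assms by (intro ln_powr_bound) auto
      moreover have "1 \<le> real n powr (1 - \<epsilon>)"
        using n assms by (intro ge_one_powr_ge_zero) auto
      ultimately have "4 + 2 * ln (real n) \<le> C * real n powr (1 - \<epsilon>)"
        by (simp add: C_def distrib_right)
      moreover have "10 * x \<le> C * x" using C x by (intro mult_right_mono) auto
      ultimately show "10 * x + 4 + 2 * ln (real n) \<le> C * x + C * real n powr (1 - \<epsilon>)" by simp
    qed simp
    also have "real n powr (1 - \<epsilon>) = real n / real n powr \<epsilon>"
      using n by (simp add: powr_diff)
    finally have "real n * Psi2 TYPE('a) n x
        \<le> real n * (C * (real q ^ n / real n powr \<epsilon> + real q ^ n * (x / real n)))"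
      using n by (simp add: algebra_simps)
    then show ?thesis by (rule mult_left_le_imp_le) (use n in simp)
  qed
  show ?thesis
    by (intro exI[of _ C] conjI allI impI bound) (use C in auto)
qed

end
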